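(* Let $\eta,\varepsilon>0$, let $f,f^\ast$ be probability mass functions on the non-negative integers, and let $\mathbf{D}_n=\{D_1,\dots,D_n\}\in\mathcal{D}_{\eta,\varepsilon}(f,f^\ast)$ be a given degree sequence. For fixed $n$, consider the optimization problem \[ \min_{G\in\mathcal{G}(\mathbf{D}_n)(f,f^\ast)}\ \frac{1}{L_n}\sum_{i\to j\in G}\mathcal{F}_n^\ast(D_i)\,\mathcal{F}_n^\ast(D_j), \] where the minimum is understood to be taken over all graphs $G_n$ with degree sequences belonging to $\mathcal{D}_{\eta,\varepsilon}(f,f^\ast)$. Then the Disassortative Graph Algorithm solves this optimization problem.
   Context: For a degree sequence $\mathbf{D}_n=\{D_1,\dots,D_n\}$ (possibly random) put $L_n=\sum_{i=1}^n D_i$, $f_n(k)=\frac1n\sum_{i=1}^n\mathbf{1}\{D_i=k\}$ and $f_n^\ast(k)=\frac{1}{L_n}\sum_{i=1}^n k\,\mathbf{1}\{D_i=k\}$, with cumulative distribution functions $F_n$ and $F_n^\ast$, and $\mathcal{F}_n^\ast(k)=F_n^\ast(k)+F_n^\ast(k-1)$. One writes $\mathbf{D}_n\in\mathcal{D}_{\eta,\varepsilon}(f,f^\ast)$ if $\sum_{k\ge0}k^{1+\eta}f(k)<\infty$ and $\mathbb{P}(\Omega_n)\to1$ as $n\to\infty$, where \[ \Omega_n=\Big\{\max\Big\{\sum_{k=0}^\infty\Big|\sum_{t=0}^k (f_n(t)-f(t))\Big|,\ \sum_{k=0}^\infty|f_n^\ast(k)-f^\ast(k)|\Big\}\le n^{-\varepsilon}\Big\}.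 \] For simplicity of notation it is assumed throughout that $f(k),f^\ast(k)>0$ for all $k\ge0$ (otherwise one considers only those $k$ for which this holds). Graphs are undirected (self-loops and multiple edges are not excluded). Each undirected edge $i-j$ is replaced by two directed edges $i\to j$ and $j\to i$, and $\sum_{i\to j\in G}$ is the sum over these directed edges, of which there are $L_n$. The notation $\mathcal{G}(\mathbf{D}_n)$ refers to graphs with degree sequence $\mathbf{D}_n$. Disassortative Graph Algorithm. Input $\mathbf{D}_n$. Node $i$ has $D_i$ stubs (half-edges) labeled $i$; $N_k$ is the number of nodes of degree $k$; $z_n$ is the unique integer with $\sum_{t=1}^{z_n}tN_t\ge L_n/2$ and $\sum_{t=1}^{z_n-1}tN_t<L_n/2$. Rank the nodes as $\phi(1),\dots,\phi(n)$ with $D_{\phi(1)}\le\dots\le D_{\phi(n)}$. List $S_n$: going through $\phi(n),\phi(n-1),\dots$ as long as the degree is $\ge z_n$, append $D_{\phi(i)}$ stubs labeled $\phi(i)$. List $T_n$: for each degree value $k\le z_n$ in increasing order, append $k$ copies of the block of labels of all $N_k$ nodes of degree $k$, in the order given by $\phi$. For $t=1,2,\dots$, as long as it is not the case that both nodes $S_n[t]$ and $T_n[t]$ have degree $z_n$, add an edge between $S_n[t]$ and $T_n[t]$. Finally, pair the remaining unpaired stubs using the configuration model. The output is the resulting graph. *)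

theory Defs
  imports "HOL-Probability.Probability" "HOL-Library.Uprod"
begin

section \<open>Degree sequences\<close>

text \<open>
  A degree sequence of length \<open>n\<close> is given by a function \<open>d\<close> on the nodes \<open>{1..n}\<close>;
  values outside this range are irrelevant.
\<close>

definition total_degree :: "nat \<Rightarrow> (nat \<Rightarrow> nat) \<Rightarrow> nat" where
  "total_degree n d = (\<Sum>i=1..n. d i)"

definition node_count :: "nat \<Rightarrow> (nat \<Rightarrow> nat) \<Rightarrow> nat \<Rightarrow> nat" where
  "node_count n d k = card {i \<in> {1..n}. d i = k}"

definition emp_pmf :: "nat \<Rightarrow> (nat \<Rightarrow> nat) \<Rightarrow> nat \<Rightarrow> real" where
  "emp_pmf n d k = (1 / real n) * (\<Sum>i=1..n. if d i = k then 1 else 0)"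

definition emp_pmf_star :: "nat \<Rightarrow> (nat \<Rightarrow> nat) \<Rightarrow> nat \<Rightarrow> real" where
  "emp_pmf_star n d k =
     (1 / real (total_degree n d)) * (\<Sum>i=1..n. real k * (if d i = k then 1 else 0))"

definition emp_cdf_star :: "nat \<Rightarrow> (nat \<Rightarrow> nat) \<Rightarrow> nat \<Rightarrow> real" where
  "emp_cdf_star n d k = (\<Sum>t\<le>k. emp_pmf_star n d t)"

text \<open>The case distinction encodes that the distribution function vanishes at \<open>-1\<close>.\<close>

definition cal_F_star :: "nat \<Rightarrow> (nat \<Rightarrow> nat) \<Rightarrow> nat \<Rightarrow> real" where
  "cal_F_star n d k = emp_cdf_star n d k + (if k = 0 then 0 else emp_cdf_star n d (k - 1))"

text \<open>
  The two series are taken in the extended non-negative reals, so that a divergent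
  series has the value \<open>\<infinity>\<close> and violates the bound.
\<close>

definition close_to :: "real \<Rightarrow> nat pmf \<Rightarrow> nat pmf \<Rightarrow> nat \<Rightarrow> (nat \<Rightarrow> nat) \<Rightarrow> bool" where
  "close_to \<epsilon> f fs n d \<longleftrightarrow>
     max (\<Sum>k. ennreal \<bar>\<Sum>t\<le>k. (emp_pmf n d t - pmf f t)\<bar>)
         (\<Sum>k. ennreal \<bar>emp_pmf_star n d k - pmf fs k\<bar>)
       \<le> ennreal (real n powr (- \<epsilon>))"

text \<open>
  \<open>D n \<omega> i\<close> is the degree of node \<open>i\<close> in the \<open>n\<close>-th (random) degree sequence. A
  deterministic sequence is the case where \<open>D n \<omega>\<close> does not depend on \<open>\<omega>\<close>.
\<close>

definition degree_class ::
  "'a measure \<Rightarrow> real \<Rightarrow> real \<Rightarrow> nat pmf \<Rightarrow> nat pmf \<Rightarrow> (nat \<Rightarrow> 'a \<Rightarrow> nat \<Rightarrow> nat) \<Rightarrow> bool" where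
  "degree_class M \<eta> \<epsilon> f fs D \<longleftrightarrow>
     (\<forall>n. \<forall>i\<in>{1..n}. (\<lambda>\<omega>. D n \<omega> i) \<in> measurable M (count_space UNIV)) \<and>
     summable (\<lambda>k. real k powr (1 + \<eta>) * pmf f k) \<and>
     (\<lambda>n. measure M {\<omega> \<in> space M. close_to \<epsilon> f fs n (D n \<omega>)}) \<longlonglongrightarrow> 1"

section \<open>Graphs\<close>

text \<open>
  An undirected graph with possible self-loops and multiple edges is a multiset of
  unordered pairs of nodes. A self-loop at \<open>i\<close> contributes two directed edges
  \<open>(i, i)\<close>, hence two to the degree of \<open>i\<close>.
\<close>

type_synonym graph = "nat uprod multiset"

lift_definition edge_arcs :: "nat uprod \<Rightarrow> (nat \<times> nat) multiset"
  is "\<lambda>(i, j). {#(i, j), (j, i)#}"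
  by auto

definition arcs :: "graph \<Rightarrow> (nat \<times> nat) multiset" where
  "arcs G = (\<Sum>e\<in>#G. edge_arcs e)"

definition degree_in :: "graph \<Rightarrow> nat \<Rightarrow> nat" where
  "degree_in G i = size {#a \<in># arcs G. fst a = i#}"

definition graphs_with_degrees :: "nat \<Rightarrow> (nat \<Rightarrow> nat) \<Rightarrow> graph set" where
  "graphs_with_degrees n d =
     {G. (\<forall>e\<in>#G. set_uprod e \<subseteq> {1..n}) \<and> (\<forall>i\<in>{1..n}. degree_in G i = d i)}"

definition joint_objective :: "nat \<Rightarrow> (nat \<Rightarrow> nat) \<Rightarrow> graph \<Rightarrow> real" where
  "joint_objective n d G =
     (1 / real (total_degree n d)) *
     (\<Sum>(i, j)\<in>#arcs G. cal_F_star n d (d i) * cal_F_star n d (d j))"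

section \<open>Configuration model\<close>

text \<open>
  A stub is a pair \<open>(i, c)\<close> whose first component is its label and whose second
  component only distinguishes the stubs at node \<open>i\<close>. The configuration model is a
  uniformly random perfect matching of the stubs, read as a graph on the labels;
  \<open>R\<close> is meant to be finite of even cardinality.
\<close>

definition stub_pairings :: "(nat \<times> nat) set \<Rightarrow> (nat \<times> nat) uprod set set" where
  "stub_pairings R =
     {P. (\<forall>e\<in>P. proper_uprod e \<and> set_uprod e \<subseteq> R) \<and> (\<forall>s\<in>R. \<exists>!e. e \<in> P \<and> s \<in> set_uprod e)}"

definition configuration_model :: "(nat \<times> nat) set \<Rightarrow> graph pmf" where
  "configuration_model R =
     map_pmf (\<lambda>P. image_mset (map_uprod fst) (mset_set P)) (pmf_of_set (stub_pairings R))"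

section \<open>Disassortative Graph Algorithm\<close>

definition degree_ranking :: "nat \<Rightarrow> (nat \<Rightarrow> nat) \<Rightarrow> (nat \<Rightarrow> nat) \<Rightarrow> bool" where
  "degree_ranking n d \<phi> \<longleftrightarrow>
     bij_betw \<phi> {1..n} {1..n} \<and> mono_on {1..n} (\<lambda>r. d (\<phi> r))"

text \<open>
  Such a \<open>z\<close> exists if and only if the total degree is positive. If the total degree
  is zero, the lists below are empty whatever the value of \<open>z\<close>.
\<close>

definition half_degree :: "nat \<Rightarrow> (nat \<Rightarrow> nat) \<Rightarrow> nat" where
  "half_degree n d =
     (THE z. real (\<Sum>t=1..z. t * node_count n d t) \<ge> real (total_degree n d) / 2 \<and>
             real (\<Sum>t=1..z - 1. t * node_count n d t) < real (total_degree n d) / 2)"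

definition ranked_nodes :: "nat \<Rightarrow> (nat \<Rightarrow> nat) \<Rightarrow> nat list" where
  "ranked_nodes n \<phi> = map \<phi> [1..<n + 1]"

definition S_list :: "nat \<Rightarrow> (nat \<Rightarrow> nat) \<Rightarrow> (nat \<Rightarrow> nat) \<Rightarrow> nat list" where
  "S_list n d \<phi> =
     concat (map (\<lambda>i. replicate (d i) i)
       (takeWhile (\<lambda>i. half_degree n d \<le> d i) (rev (ranked_nodes n \<phi>))))"

definition T_list :: "nat \<Rightarrow> (nat \<Rightarrow> nat) \<Rightarrow> (nat \<Rightarrow> nat) \<Rightarrow> nat list" where
  "T_list n d \<phi> =
     concat (map (\<lambda>k. concat (replicate k (filter (\<lambda>i. d i = k) (ranked_nodes n \<phi>))))
       [0..<half_degree n d + 1])"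

text \<open>
  The joining phase also stops when one of the two lists is exhausted. With \<open>\<phi>\<close> a
  ranking and positive total degree, this happens first only if the stubs at nodes of
  degree at most \<open>z\<close> make up exactly half of all stubs, and then all stubs are paired.
\<close>

definition joined_edges :: "nat \<Rightarrow> (nat \<Rightarrow> nat) \<Rightarrow> (nat \<Rightarrow> nat) \<Rightarrow> graph" where
  "joined_edges n d \<phi> =
     mset (map (\<lambda>(i, j). Upair i j)
       (takeWhile (\<lambda>(i, j). \<not> (d i = half_degree n d \<and> d j = half_degree n d))
         (zip (S_list n d \<phi>) (T_list n d \<phi>))))"

definition unpaired_stubs :: "nat \<Rightarrow> (nat \<Rightarrow> nat) \<Rightarrow> (nat \<Rightarrow> nat) \<Rightarrow> (nat \<times> nat) set" where
  "unpaired_stubs n d \<phi> =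
     {(i, c). i \<in> {1..n} \<and> degree_in (joined_edges n d \<phi>) i \<le> c \<and> c < d i}"

definition disassortative_graph :: "nat \<Rightarrow> (nat \<Rightarrow> nat) \<Rightarrow> (nat \<Rightarrow> nat) \<Rightarrow> graph pmf" where
  "disassortative_graph n d \<phi> =
     map_pmf (\<lambda>H. joined_edges n d \<phi> + H) (configuration_model (unpaired_stubs n d \<phi>))"

end

theory Submission
  imports Defs
begin

text \<open>
  Write the objective as a sum over thresholds \<open>s\<close>, \<open>t\<close>: since \<open>cal_F_star\<close> is nonnegative and
  nondecreasing, it is a nonnegative combination of the numbers of arcs \<open>(i, j)\<close> with
  \<open>s \<le> d i\<close> and \<open>t \<le> d j\<close>. The marginals of the arcs are fixed by the degrees, so each of these
  numbers is minimal once the arcs are countermonotone, that is, larger degrees of the tail come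
  with smaller degrees of the head. The algorithm matches stubs of decreasing degree with stubs
  of increasing degree, both meeting at \<open>half_degree\<close>, and all stubs left to the configuration
  model have that degree, so every possible output is countermonotone.
\<close>

section \<open>Countermonotone multisets of pairs\<close>

text \<open>
  Discrete form of the extremality of the lower Frechet-Hoeffding bound: for every pair of
  thresholds a countermonotone multiset has an empty upper or an empty lower quadrant, and the
  difference of the sizes of these two quadrants depends on the marginals only.
\<close>

lemma size_quadrant_countermonotone_le:
  fixes A B :: "(nat \<times> nat) multiset"
  assumes fst_eq: "image_mset fst A = image_mset fst B"
    and snd_eq: "image_mset snd A = image_mset snd B"
    and anti: "\<And>x y x' y'. \<lbrakk>(x, y) \<in># A; (x', y') \<in># A; x < x'\<rbrakk> \<Longrightarrow> y' \<le> y"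
  shows "size {#p \<in># A. s \<le> fst p \<and> t \<le> snd p#} \<le> size {#p \<in># B. s \<le> fst p \<and> t \<le> snd p#}"
proof -
  let ?up = "\<lambda>C. size {#p \<in># C. s \<le> fst p \<and> t \<le> snd p#}"
  let ?lo = "\<lambda>C. size {#p \<in># C. fst p < s \<and> snd p < t#}"
  have quad: "?up C + size {#y \<in># image_mset snd C. y < t#}
      = ?lo C + size {#x \<in># image_mset fst C. s \<le> x#}" for C :: "(nat \<times> nat) multiset"
    by (induction C) auto
  have eq: "?up A + ?lo B = ?up B + ?lo A"
    using quad[of A] quad[of B] unfolding fst_eq snd_eq by linarith
  have "?up A = 0 \<or> ?lo A = 0"
  proof (rule ccontr)
    assume "\<not> (?up A = 0 \<or> ?lo A = 0)"
    then obtain p q where "p \<in># A" "s \<le> fst p" "t \<le> snd p"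
      and "q \<in># A" "fst q < s" "snd q < t"
      by fastforce
    then show False using anti[of "fst q" "snd q" "fst p" "snd p"] by auto
  qed
  then show ?thesis using eq by linarith
qed

text \<open>The increments of \<open>g\<close> telescope. Extending the sum to a common bound
  \<open>K\<close> lets one set of weights serve all \<open>k\<close>; the weights are nonnegative
  when \<open>g\<close> is nondecreasing and \<open>0 \<le> g 0\<close>.\<close>

lemma layer_sum:
  fixes g :: "nat \<Rightarrow> real"
  assumes "k \<le> K"
  shows "g k = (\<Sum>s\<le>K. (if s = 0 then g 0 else g s - g (s - 1)) * of_bool (s \<le> k))"
proof -
  let ?w = "\<lambda>s. if s = 0 then g 0 else g s - g (s - 1)"
  have "(\<Sum>s\<le>K. ?w s * of_bool (s \<le> k)) = (\<Sum>s\<le>k. ?w s)"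
    using assms by (intro sum.mono_neutral_cong_right) auto
  also have "\<dots> = g k" by (induction k) auto
  finally show ?thesis by simp
qed

text \<open>Expanding both factors into layers and exchanging sums leaves dependence on
  \<open>A\<close> only through quadrant sizes, the quantities compared above.\<close>

lemma sum_prod_layers:
  fixes f g v w :: "nat \<Rightarrow> real" and A :: "(nat \<times> nat) multiset"
  assumes "\<And>k. k \<le> K \<Longrightarrow> f k = (\<Sum>s\<le>K. v s * of_bool (s \<le> k))"
    and "\<And>k. k \<le> K \<Longrightarrow> g k = (\<Sum>s\<le>K. w s * of_bool (s \<le> k))"
    and "\<And>p. p \<in># A \<Longrightarrow> fst p \<le> K \<and> snd p \<le> K"
  shows "(\<Sum>p\<in>#A. f (fst p) * g (snd p)) =
    (\<Sum>s\<le>K. \<Sum>t\<le>K. v s * w t * real (size {#p \<in># A. s \<le> fst p \<and> t \<le> snd p#}))"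
  using assms(3)
proof (induction A)
  case empty
  then show ?case by simp
next
  case (add p A)
  have "f (fst p) * g (snd p) =
      (\<Sum>s\<le>K. \<Sum>t\<le>K. v s * w t * of_bool (s \<le> fst p \<and> t \<le> snd p))"
  proof -
    have "fst p \<le> K" "snd p \<le> K" using add.prems by auto
    then show ?thesis
      by (simp only: assms(1)[of "fst p"] assms(2)[of "snd p"] sum_product of_bool_conj mult_ac)
  qed
  moreover have "real (size {#q \<in># add_mset p A. s \<le> fst q \<and> t \<le> snd q#}) =
      of_bool (s \<le> fst p \<and> t \<le> snd p) + real (size {#q \<in># A. s \<le> fst q \<and> t \<le> snd q#})" for s t
    by simp
  ultimately show ?case using add
    by (simp only: distrib_left sum.distrib) simp
qed

lemma sum_prod_countermonotone_le:
  fixes f g :: "nat \<Rightarrow> real" and A B :: "(nat \<times> nat) multiset"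
  assumes "image_mset fst A = image_mset fst B" and "image_mset snd A = image_mset snd B"
    and "\<And>x y x' y'. \<lbrakk>(x, y) \<in># A; (x', y') \<in># A; x < x'\<rbrakk> \<Longrightarrow> y' \<le> y"
    and f: "mono f" "0 \<le> f 0" and g: "mono g" "0 \<le> g 0"
  shows "(\<Sum>p\<in>#A. f (fst p) * g (snd p)) \<le> (\<Sum>p\<in>#B. f (fst p) * g (snd p))"
proof -
  define v where "v s = (if s = 0 then f 0 else f s - f (s - 1))" for s
  define w where "w s = (if s = 0 then g 0 else g s - g (s - 1))" for s
  have nonneg: "0 \<le> v s" "0 \<le> w s" for s
    using f g by (auto simp: v_def w_def monoD)
  \<comment> \<open>One bound for both multisets, so that \<open>A\<close> and \<open>B\<close> are
    expanded with the same layer weights.\<close>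
  define K where "K = Max (fst ` set_mset (A + B) \<union> snd ` set_mset (A + B))"
  have K: "fst p \<le> K \<and> snd p \<le> K" if "p \<in># A + B" for p
    using that unfolding K_def by (intro conjI Max_ge) auto
  have layers: "(\<Sum>p\<in>#C. f (fst p) * g (snd p)) =
      (\<Sum>s\<le>K. \<Sum>t\<le>K. v s * w t * real (size {#p \<in># C. s \<le> fst p \<and> t \<le> snd p#}))"
    if "C \<subseteq># A + B" for C
    using that K unfolding v_def w_def
    by (intro sum_prod_layers layer_sum) (auto dest: mset_subset_eqD)
  show ?thesis
    by (subst (1 2) layers)
      (auto intro!: sum_mono mult_left_mono mult_nonneg_nonneg nonneg
        size_quadrant_countermonotone_le[OF assms(1-3)])
qed

section \<open>Arcs and degrees\<close>

lemma edge_arcs_Upair [simp]: "edge_arcs (Upair a b) = {#(a, b), (b, a)#}"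
  by transfer simp

lemma arcs_simps [simp]:
  "arcs {#} = {#}"
  "arcs (add_mset (Upair a b) G) = add_mset (a, b) (add_mset (b, a) (arcs G))"
  "arcs (G + H) = arcs G + arcs H"
  by (auto simp: arcs_def)

lemma Upair_mset_induct [case_names empty add]:
  assumes "P {#}" and "\<And>a b G. P G \<Longrightarrow> P (add_mset (Upair a b) G)"
  shows "P G"
proof (induction G)
  case (add e G)
  then show ?case using assms(2) by (cases e) auto
qed (rule assms(1))

text \<open>Every edge contributes both orientations, so control of the tails suffices for both
  marginals.\<close>

lemma image_snd_arcs: "image_mset snd (arcs G) = image_mset fst (arcs G)"
  by (induction G rule: Upair_mset_induct) auto

lemma mem_arcs_iff: "(a, b) \<in># arcs G \<longleftrightarrow> Upair a b \<in># G"
  by (induction G rule: Upair_mset_induct) auto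

lemma degree_in_eq_count: "degree_in G i = count (image_mset fst (arcs G)) i"
  unfolding degree_in_def by (induction G rule: Upair_mset_induct) auto

lemma degree_in_plus [simp]: "degree_in (G + H) i = degree_in G i + degree_in H i"
  by (simp add: degree_in_eq_count)

lemma degree_in_Upairs:
  "degree_in (mset (map (\<lambda>(i, j). Upair i j) ps)) i =
    count_list (map fst ps) i + count_list (map snd ps) i"
  unfolding degree_in_eq_count by (induction ps) auto

lemma degree_in_sum: "degree_in G i = (\<Sum>e\<in>#G. degree_in {#e#} i)"
proof (induction G rule: Upair_mset_induct)
  case (add a b G)
  then show ?case using degree_in_plus[of "{#Upair a b#}" G] by simp
qed (simp add: degree_in_def)

section \<open>The objective in terms of degree pairs, and a criterion for minimisers\<close>

lemma joint_objective_degree_pairs: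
  "joint_objective n d G = (1 / real (total_degree n d)) *
    (\<Sum>p\<in>#image_mset (map_prod d d) (arcs G). cal_F_star n d (fst p) * cal_F_star n d (snd p))"
  by (simp add: joint_objective_def multiset.map_comp o_def case_prod_unfold)

lemma emp_pmf_star_nonneg: "0 \<le> emp_pmf_star n d k"
  unfolding emp_pmf_star_def by (intro mult_nonneg_nonneg sum_nonneg) auto

lemma mono_emp_cdf_star: "mono (emp_cdf_star n d)"
  unfolding emp_cdf_star_def by (intro monoI sum_mono2) (auto intro: emp_pmf_star_nonneg)

lemma emp_cdf_star_nonneg: "0 \<le> emp_cdf_star n d k"
  unfolding emp_cdf_star_def by (intro sum_nonneg emp_pmf_star_nonneg)

lemma mono_cal_F_star: "mono (cal_F_star n d)"
proof (rule monoI)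
  fix k l :: nat
  assume "k \<le> l"
  then show "cal_F_star n d k \<le> cal_F_star n d l"
    \<comment> \<open>Nonnegativity covers \<open>k = 0 < l\<close>, where the second summand passes
      from the default value 0 to \<open>emp_cdf_star n d (l - 1)\<close>.\<close>
    using monoD[OF mono_emp_cdf_star, of k l n d]
      monoD[OF mono_emp_cdf_star diff_le_mono, of k l n d 1] emp_cdf_star_nonneg[of n d "l - 1"]
    by (auto simp: cal_F_star_def intro: add_mono add_increasing2)
qed

text \<open>A node of \<open>{1..n}\<close> is a tail as often as its prescribed degree; other nodes
  lie on no edge.\<close>

lemma image_fst_arcs_eq:
  assumes "G \<in> graphs_with_degrees n d" "H \<in> graphs_with_degrees n d"
  shows "image_mset fst (arcs G) = image_mset fst (arcs H)"
proof (rule multiset_eqI)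
  fix i
  have zero: "count (image_mset fst (arcs G)) i = 0"
    if "G \<in> graphs_with_degrees n d" "i \<notin> {1..n}" for G
  proof -
    have "fst p \<in> {1..n}" if "p \<in># arcs G" for p
      using that \<open>G \<in> _\<close> mem_arcs_iff[of "fst p" "snd p" G]
      by (force simp: graphs_with_degrees_def)
    then show ?thesis using that(2) by (auto simp: count_eq_zero_iff simp del: count_image_mset)
  qed
  show "count (image_mset fst (arcs G)) i = count (image_mset fst (arcs H)) i"
    using assms zero[OF assms(1)] zero[OF assms(2)]
    by (cases "i \<in> {1..n}") (auto simp: graphs_with_degrees_def degree_in_eq_count)
qed

text \<open>Both marginals of the degree pairs are images under \<open>d\<close> of the tail
  marginal, hence shared by all competitors, and the countermonotone comparison applies.\<close>

lemma is_arg_min_countermonotone: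
  assumes G: "G \<in> graphs_with_degrees n d"
    and anti: "\<And>i j i' j'. \<lbrakk>(i, j) \<in># arcs G; (i', j') \<in># arcs G; d i < d i'\<rbrakk> \<Longrightarrow> d j' \<le> d j"
  shows "is_arg_min (joint_objective n d) (\<lambda>H. H \<in> graphs_with_degrees n d) G"
proof -
  have "joint_objective n d G \<le> joint_objective n d H" if H: "H \<in> graphs_with_degrees n d" for H
  proof -
    have marg: "image_mset fst (image_mset (map_prod d d) C) = image_mset d (image_mset fst C)"
      "image_mset snd (image_mset (map_prod d d) C) = image_mset d (image_mset snd C)"
      for C :: "(nat \<times> nat) multiset"
      by (simp_all add: multiset.map_comp o_def)
    show ?thesis unfolding joint_objective_degree_pairs
      by (intro mult_left_mono sum_prod_countermonotone_le mono_cal_F_star)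
        (auto simp only: marg image_snd_arcs image_fst_arcs_eq[OF G H],
         auto simp: cal_F_star_def emp_cdf_star_nonneg dest: anti)
  qed
  then show ?thesis using G by (auto simp: is_arg_min_def not_less)
qed

section \<open>Pairings of stubs\<close>

text \<open>One bounding set yields finiteness both of each pairing and of the set of all
  pairings.\<close>

lemma stub_pairings_subset: "stub_pairings R \<subseteq> Pow ((\<lambda>(a, b). Upair a b) ` (R \<times> R))"
proof clarify
  fix P e
  assume "P \<in> stub_pairings R" "e \<in> P"
  then show "e \<in> (\<lambda>(a, b). Upair a b) ` (R \<times> R)"
    by (cases e) (force simp: stub_pairings_def)
qed

lemma finite_stub_pairings: "finite R \<Longrightarrow> finite (stub_pairings R)"
  by (rule finite_subset[OF stub_pairings_subset]) auto

lemma finite_stub_pairing: "finite R \<Longrightarrow> P \<in> stub_pairings R \<Longrightarrow> finite P"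
  by (rule finite_subset[of _ "(\<lambda>(a, b). Upair a b) ` (R \<times> R)"])
    (use stub_pairings_subset[of R] in auto)

text \<open>Together with finiteness this identifies the support of \<open>pmf_of_set\<close>. Two
  stubs are split off and paired with each other; induction pairs the rest.\<close>

lemma stub_pairings_nonempty:
  assumes "finite R" "even (card R)"
  shows "stub_pairings R \<noteq> {}"
  using assms
proof (induction "card R" arbitrary: R rule: less_induct)
  case less
  show ?case
  proof (cases "R = {}")
    case True
    then have "{} \<in> stub_pairings R" by (auto simp: stub_pairings_def)
    then show ?thesis by blast
  next
    case False
    then obtain a where a: "a \<in> R" by blast
    have "R - {a} \<noteq> {}"
    proof
      assume "R - {a} = {}"
      then have "R = {a}" using a by blast
      then show False using less.prems by simp
    qed
    then obtain b where b: "b \<in> R" "b \<noteq> a" by blast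
    define Q where "Q = R - {a, b}"
    have "R = insert a (insert b Q)" and "a \<notin> insert b Q" "b \<notin> Q" and fin: "finite Q"
      using a b less.prems by (auto simp: Q_def)
    then have "card R = card Q + 2" by simp
    then obtain P where P: "P \<in> stub_pairings Q"
      using less.hyps[of Q] less.prems fin by auto
    have notin: "s \<notin> set_uprod e" if "e \<in> P" "s \<in> {a, b}" for e s
      using that P by (auto simp: stub_pairings_def Q_def)
    have ex1: "\<exists>!e. e \<in> insert (Upair a b) P \<and> s \<in> set_uprod e" if s: "s \<in> R" for s
    proof (cases "s \<in> {a, b}")
      case True
      then show ?thesis using notin[of _ s] by auto
    next
      case False
      then have "\<exists>!e. e \<in> P \<and> s \<in> set_uprod e" using s P by (auto simp: stub_pairings_def Q_def)
      then show ?thesis using False by auto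
    qed
    have "proper_uprod e \<and> set_uprod e \<subseteq> R" if "e \<in> insert (Upair a b) P" for e
      using that P a b by (auto simp: stub_pairings_def Q_def)
    then have "insert (Upair a b) P \<in> stub_pairings R"
      using ex1 by (simp add: stub_pairings_def)
    then show ?thesis by blast
  qed
qed

text \<open>Each pair adds to the degree of \<open>i\<close> the number of its stubs at
  \<open>i\<close>, and the pairs partition \<open>R\<close>.\<close>

lemma degree_in_stub_pairing:
  assumes "finite R" "P \<in> stub_pairings R"
  shows "degree_in (image_mset (map_uprod fst) (mset_set P)) i = card {s \<in> R. fst s = i}"
proof -
  have fin: "finite P" using assms by (rule finite_stub_pairing)
  have card_ends: "degree_in {#map_uprod fst e#} i = card {s \<in> set_uprod e. fst s = i}"
    if "e \<in> P" for e
  proof (cases e)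
    case (Upair a b)
    \<comment> \<open>Properness makes a loop count twice: it joins two distinct stubs with the same
      label.\<close>
    then have "a \<noteq> b" using that assms(2) by (auto simp: stub_pairings_def)
    moreover have "{s \<in> {a, b}. fst s = i} =
        (if fst a = i then {a} else {}) \<union> (if fst b = i then {b} else {})"
      by auto
    ultimately show ?thesis using Upair by (auto simp: degree_in_def)
  qed
  have "degree_in (image_mset (map_uprod fst) (mset_set P)) i =
      (\<Sum>e\<in>P. degree_in {#map_uprod fst e#} i)"
    by (subst degree_in_sum) (simp add: multiset.map_comp o_def sum_unfold_sum_mset)
  also have "\<dots> = (\<Sum>e\<in>P. card {s \<in> set_uprod e. fst s = i})"
    using card_ends by simp
  also have "\<dots> = card (\<Union>e\<in>P. {s \<in> set_uprod e. fst s = i})"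
  proof (rule card_UN_disjoint[symmetric])
    show "\<forall>e\<in>P. \<forall>e'\<in>P. e \<noteq> e' \<longrightarrow>
        {s \<in> set_uprod e. fst s = i} \<inter> {s \<in> set_uprod e'. fst s = i} = {}"
    proof (intro ballI impI)
      fix e e'
      assume e: "e \<in> P" "e' \<in> P" "e \<noteq> e'"
      have "\<not> (s \<in> set_uprod e \<and> s \<in> set_uprod e')" for s
        using assms(2) e unfolding stub_pairings_def by blast
      then show "{s \<in> set_uprod e. fst s = i} \<inter> {s \<in> set_uprod e'. fst s = i} = {}"
        by blast
    qed
  qed (use fin in auto)
  also have "(\<Union>e\<in>P. {s \<in> set_uprod e. fst s = i}) = {s \<in> R. fst s = i}"
    using assms(2) unfolding stub_pairings_def by blast
  finally show ?thesis .
qed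

section \<open>The joining phase\<close>

text \<open>Since \<open>P\<close> passes from later to earlier entries, the entries satisfying it
  form a prefix. This cuts the stub lists at the threshold degree.\<close>

lemma sorted_wrt_partition:
  assumes "sorted_wrt r xs" and "\<And>x y. \<lbrakk>x \<in> set xs; y \<in> set xs; r x y; P y\<rbrakk> \<Longrightarrow> P x"
  shows "xs = filter P xs @ filter (\<lambda>x. \<not> P x) xs"
  using assms
proof (induction xs)
  case (Cons x xs)
  show ?case
  proof (cases "P x")
    case True
    then show ?thesis using Cons.IH Cons.prems by fastforce
  next
    case False
    then have "\<not> P y" if "y \<in> set xs" for y
      using that Cons.prems by auto
    then show ?thesis using False by (simp add: filter_empty_conv)
  qed
qed simp

lemma count_list_concat_replicate: "count_list (concat (replicate k xs)) i = k * count_list xs i"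
  by (induction k) auto

lemma count_list_concat_stubs:
  "distinct xs \<Longrightarrow> count_list (concat (map (\<lambda>i. replicate (d i) i) xs)) j =
    (if j \<in> set xs then d j else 0)"
proof (induction xs)
  case (Cons x xs)
  have "count_list (replicate m x) j = (if x = j then m else 0)" for m
    by (induction m) auto
  then show ?case using Cons by auto
qed simp

lemma count_list_distinct: "distinct xs \<Longrightarrow> count_list xs i = of_bool (i \<in> set xs)"
  by (induction xs) auto

lemma count_list_concat_blocks:
  assumes "distinct xs" "distinct ks"
  shows "count_list (concat (map (\<lambda>k. concat (replicate k (filter (\<lambda>i. d i = k) xs))) ks)) j =
    (if j \<in> set xs \<and> d j \<in> set ks then d j else 0)"
  using assms(2)
  by (induction ks) (auto simp: count_list_concat_replicate count_list_distinct assms(1))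

lemma length_filter_eq_sum_count_list:
  assumes "set xs \<subseteq> A" "finite A"
  shows "length (filter P xs) = (\<Sum>i | i \<in> A \<and> P i. count_list xs i)"
proof -
  have "count_list (filter P xs) i = count_list xs i" if "P i" for i
    using that by (induction xs) auto
  moreover have "length (filter P xs) = (\<Sum>i | i \<in> A \<and> P i. count_list (filter P xs) i)"
    using assms by (intro sum_count_set[symmetric]) auto
  ultimately show ?thesis by simp
qed

section \<open>The weighted median of the degrees\<close>

lemma sum_degrees_le_eq:
  "(\<Sum>t=1..z. t * node_count n d t) = (\<Sum>i | i \<in> {1..n} \<and> d i \<le> z. d i)"
proof -
  have "(\<Sum>t=1..z. t * node_count n d t) = (\<Sum>t=0..z. t * node_count n d t)"
    \<comment> \<open>The term for \<open>t = 0\<close> vanishes; adding it lets nodes of degree 0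
      take part in the grouping by degree.\<close>
    by (intro sum.mono_neutral_left) auto
  also have "\<dots> = (\<Sum>t=0..z. \<Sum>i | i \<in> {i \<in> {1..n}. d i \<le> z} \<and> d i = t. d i)"
  proof (rule sum.cong)
    fix t
    assume "t \<in> {0..z}"
    then have "{i. i \<in> {i \<in> {1..n}. d i \<le> z} \<and> d i = t} = {i \<in> {1..n}. d i = t}" by auto
    then show "t * node_count n d t = (\<Sum>i | i \<in> {i \<in> {1..n}. d i \<le> z} \<and> d i = t. d i)"
      by (simp add: node_count_def)
  qed simp
  also have "\<dots> = (\<Sum>i | i \<in> {1..n} \<and> d i \<le> z. d i)"
    by (rule sum.group) auto
  finally show ?thesis .
qed

text \<open>The partial sums \<open>g\<close> are monotone, start at 0 and reach the total degree at
  the largest degree, so there is a unique index where they reach half of it.\<close>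

lemma half_degree:
  assumes "0 < total_degree n d"
  defines "z \<equiv> half_degree n d"
  shows "total_degree n d \<le> 2 * (\<Sum>i | i \<in> {1..n} \<and> d i \<le> z. d i)"
    and "2 * (\<Sum>i | i \<in> {1..n} \<and> d i < z. d i) < total_degree n d"
proof -
  define g where "g z = (\<Sum>t=1..z. t * node_count n d t)" for z
  have mono: "g x \<le> g y" if "x \<le> y" for x y
    unfolding g_def using that by (intro sum_mono2) auto
  define P where "P z \<longleftrightarrow> real (g z) \<ge> real (total_degree n d) / 2 \<and>
    real (g (z - 1)) < real (total_degree n d) / 2" for z
  have "{i \<in> {1..n}. d i \<le> Max (d ` {1..n})} = {1..n}" by auto
  then have "g (Max (d ` {1..n})) = total_degree n d"
    unfolding g_def sum_degrees_le_eq total_degree_def by simp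
  then have ex: "\<exists>z. total_degree n d \<le> 2 * g z" by (metis le_add1 mult_2)
  define y where "y = (LEAST z. total_degree n d \<le> 2 * g z)"
  have y: "total_degree n d \<le> 2 * g y"
    unfolding y_def using ex by (rule LeastI_ex)
  have "g 0 = 0" by (simp add: g_def)
  then have "y \<noteq> 0" using y assms(1) by (intro notI) simp
  then have "\<not> total_degree n d \<le> 2 * g (y - 1)"
    unfolding y_def by (intro not_less_Least) simp
  then have "P y" using y by (simp add: P_def)
  moreover have "x = y" if "P x" for x
  proof (rule ccontr)
    assume "x \<noteq> y"
    then have "g x \<le> g (y - 1) \<or> g y \<le> g (x - 1)"
      using mono[of x "y - 1"] mono[of y "x - 1"] by linarith
    then show False using that \<open>P y\<close> by (auto simp: P_def)
  qed
  ultimately have "P z"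
    unfolding z_def half_degree_def P_def g_def by (rule theI)
  then have le: "total_degree n d \<le> 2 * g z" and lt: "2 * g (z - 1) < total_degree n d"
    by (auto simp: P_def)
  show "total_degree n d \<le> 2 * (\<Sum>i | i \<in> {1..n} \<and> d i \<le> z. d i)"
    using le unfolding g_def sum_degrees_le_eq .
  \<comment> \<open>Subtraction is truncated, so \<open>z = 0\<close> must be excluded before
    \<open>d i \<le> z - 1\<close> can be read as \<open>d i < z\<close>.\<close>
  have "z \<noteq> 0" using le \<open>g 0 = 0\<close> assms(1) by (metis mult_is_0 not_less)
  then have "{i \<in> {1..n}. d i \<le> z - 1} = {i \<in> {1..n}. d i < z}" by auto
  then show "2 * (\<Sum>i | i \<in> {1..n} \<and> d i < z. d i) < total_degree n d"
    using lt unfolding g_def sum_degrees_le_eq by simp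
qed

text \<open>
  With \<open>A\<close> the number of entries of degree above \<open>z\<close> in \<open>S\<close> and \<open>C\<close> the number of entries of
  degree below \<open>z\<close> in \<open>T\<close>, exactly \<open>max A C\<close> steps are made. Hence entries of degree \<open>z\<close> are
  used from at most one of the two lists, which is why the last bound has \<open>max\<close> and not \<open>+\<close>.
\<close>

lemma joining_phase_counts:
  fixes d :: "nat \<Rightarrow> nat"
  assumes S: "sorted_wrt (\<lambda>i j. d j \<le> d i) S" "\<forall>i\<in>set S. z \<le> d i"
    and T: "sorted_wrt (\<lambda>i j. d i \<le> d j) T" "\<forall>i\<in>set T. d i \<le> z"
    and AT: "length (filter (\<lambda>i. z < d i) S) \<le> length T"
    and CS: "length (filter (\<lambda>i. d i < z) T) \<le> length S"
  defines "ps \<equiv> takeWhile (\<lambda>(i, j). \<not> (d i = z \<and> d j = z)) (zip S T)"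
  shows "z < d i \<Longrightarrow> count_list (map fst ps) i = count_list S i"
    and "d i < z \<Longrightarrow> count_list (map snd ps) i = count_list T i"
    and "d i = z \<Longrightarrow> count_list (map fst ps) i + count_list (map snd ps) i \<le>
      max (count_list S i) (count_list T i)"
proof -
  define S1 S2 where "S1 = filter (\<lambda>i. z < d i) S" and "S2 = filter (\<lambda>i. \<not> z < d i) S"
  define T1 T2 where "T1 = filter (\<lambda>i. d i < z) T" and "T2 = filter (\<lambda>i. \<not> d i < z) T"
  have S_eq: "S = S1 @ S2" unfolding S1_def S2_def
    by (rule sorted_wrt_partition[OF S(1)]) simp
  have T_eq: "T = T1 @ T2" unfolding T1_def T2_def
    by (rule sorted_wrt_partition[OF T(1)]) simp
  have S12: "\<forall>i\<in>set S1. z < d i" "\<forall>i\<in>set S2. d i = z"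
    using S(2) by (auto simp: S1_def S2_def)
  have T12: "\<forall>i\<in>set T1. d i < z" "\<forall>i\<in>set T2. d i = z"
    using T(2) by (auto simp: T1_def T2_def)
  define A C m where "A = length S1" and "C = length T1" and "m = length ps"
  have nthS: "d (S ! p) = z \<longleftrightarrow> A \<le> p" if "p < length S" for p
    using that S12 by (auto simp: S_eq nth_append A_def)
  have nthT: "d (T ! p) = z \<longleftrightarrow> C \<le> p" if "p < length T" for p
    using that T12 by (auto simp: T_eq nth_append C_def)
  have bounds: "A \<le> length S" "A \<le> length T" "C \<le> length S" "C \<le> length T"
    using AT[folded S1_def] CS[folded T1_def] by (auto simp: A_def C_def S1_def T1_def)
  have m_le: "m \<le> length S" "m \<le> length T"
    using length_takeWhile_le[of _ "zip S T"] by (auto simp: m_def ps_def)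
  have ps: "ps = zip (take m S) (take m T)"
    unfolding m_def ps_def take_zip[symmetric] by (rule takeWhile_eq_take)
  have fst_ps: "map fst ps = take m S" and snd_ps: "map snd ps = take m T"
    using m_le by (simp_all add: ps)
  \<comment> \<open>Either position \<open>m\<close> has degree \<open>z\<close> in both lists, or
    the shorter list is exhausted, and both lists have length at least \<open>A\<close> and
    \<open>C\<close>.\<close>
  have "A \<le> m \<and> C \<le> m"
  proof (cases "m < length (zip S T)")
    case True
    then have "\<not> (\<lambda>(i, j). \<not> (d i = z \<and> d j = z)) (zip S T ! m)"
      unfolding m_def ps_def by (rule nth_length_takeWhile)
    then show ?thesis using True nthS nthT by simp
  qed (use bounds in auto)
  then have take_eq: "take m S = S1 @ take (m - A) S2" "take m T = T1 @ take (m - C) T2"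
    by (simp_all add: S_eq T_eq A_def C_def)
  have "z < d i \<Longrightarrow> i \<notin> set S2" "d i < z \<Longrightarrow> i \<notin> set T2"
    using S12(2) T12(2) by auto
  then show "z < d i \<Longrightarrow> count_list (map fst ps) i = count_list S i"
    and "d i < z \<Longrightarrow> count_list (map snd ps) i = count_list T i"
    unfolding fst_ps snd_ps take_eq
    by (simp_all add: S_eq T_eq count_notin) (blast intro: count_notin dest: in_set_takeD)+
  \<comment> \<open>Otherwise position \<open>max A C\<close>, where both entries have degree
    \<open>z\<close>, would have been joined.\<close>
  have m_cases: "m \<le> A \<or> m \<le> C"
  proof (rule ccontr)
    assume "\<not> (m \<le> A \<or> m \<le> C)"
    then have p: "max A C < m" by simp
    then have "ps ! max A C \<in> set ps" by (simp add: m_def)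
    moreover have "ps ! max A C = (S ! max A C, T ! max A C)"
      using p m_le by (simp add: ps)
    ultimately have "\<not> (d (S ! max A C) = z \<and> d (T ! max A C) = z)"
      unfolding ps_def by (auto dest!: set_takeWhileD)
    then show False using nthS nthT p m_le by simp
  qed
  have count_take: "count_list (take m xs) i \<le> count_list xs i" for xs :: "nat list"
    by (metis append_take_drop_id count_list_append le_add1)
  show "count_list (map fst ps) i + count_list (map snd ps) i \<le>
      max (count_list S i) (count_list T i)" if "d i = z"
    using m_cases
  proof
    assume "m \<le> A"
    then have "count_list (take m S) i = 0"
      using that S12 by (auto simp: S_eq A_def count_list_0_iff dest: in_set_takeD)
    then show ?thesis using count_take[of T] by (simp add: fst_ps snd_ps)
  next
    assume "m \<le> C"
    then have "count_list (take m T) i = 0"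
      using that T12 by (auto simp: T_eq C_def count_list_0_iff dest: in_set_takeD)
    then show ?thesis using count_take[of S] by (simp add: fst_ps snd_ps)
  qed
qed

section \<open>Multiplicities and order in the two stub lists\<close>

lemma ranked_nodes:
  assumes "degree_ranking n d \<phi>"
  shows "distinct (ranked_nodes n \<phi>)" and "set (ranked_nodes n \<phi>) = {1..n}"
    and "sorted_wrt (\<lambda>i j. d i \<le> d j) (ranked_nodes n \<phi>)"
proof -
  have bij: "bij_betw \<phi> {1..n} {1..n}" and mono: "mono_on {1..n} (\<lambda>r. d (\<phi> r))"
    using assms by (auto simp: degree_ranking_def)
  have set: "set [1..<n + 1] = {1..n}" by auto
  show "distinct (ranked_nodes n \<phi>)" "set (ranked_nodes n \<phi>) = {1..n}"
    using bij set unfolding ranked_nodes_def distinct_map set_map by (auto simp: bij_betw_def)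
  show "sorted_wrt (\<lambda>i j. d i \<le> d j) (ranked_nodes n \<phi>)"
    unfolding ranked_nodes_def sorted_wrt_map
    by (rule sorted_wrt_mono_rel[OF _ sorted_wrt_upt])
      (use set in \<open>auto intro!: mono_onD[OF mono]\<close>)
qed

lemma S_list_properties:
  fixes d :: "nat \<Rightarrow> nat"
  assumes "degree_ranking n d \<phi>"
  shows "count_list (S_list n d \<phi>) i = (if i \<in> {1..n} \<and> half_degree n d \<le> d i then d i else 0)"
    and "set (S_list n d \<phi>) \<subseteq> {1..n}" and "\<forall>i\<in>set (S_list n d \<phi>). half_degree n d \<le> d i"
    and "sorted_wrt (\<lambda>i j. d j \<le> d i) (S_list n d \<phi>)"
proof -
  let ?P = "\<lambda>i. half_degree n d \<le> d i" and ?rs = "rev (ranked_nodes n \<phi>)"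
  have sorted: "sorted_wrt (\<lambda>i j. d j \<le> d i) ?rs"
    using ranked_nodes(3)[OF assms] by (simp add: sorted_wrt_rev)
  \<comment> \<open>Degrees decrease along the reversed ranking, so the nodes of degree at least
    \<open>half_degree n d\<close> form a prefix and \<open>takeWhile\<close> acts as
    \<open>filter\<close>.\<close>
  have "takeWhile ?P (filter (\<lambda>i. \<not> ?P i) xs) = []" for xs
    by (induction xs) auto
  then have "takeWhile ?P (filter ?P xs @ filter (\<lambda>i. \<not> ?P i) xs) = filter ?P xs" for xs
    by (subst takeWhile_append2) auto
  then have eq: "takeWhile ?P ?rs = filter ?P ?rs"
    using sorted_wrt_partition[OF sorted, of ?P] by (metis le_trans)
  note S_eq = S_list_def[of n d \<phi>, unfolded eq]
  show count: "count_list (S_list n d \<phi>) i =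
      (if i \<in> {1..n} \<and> half_degree n d \<le> d i then d i else 0)" for i
    unfolding S_eq using ranked_nodes(1,2)[OF assms] by (subst count_list_concat_stubs) auto
  have "i \<in> {1..n} \<and> ?P i" if "i \<in> set (S_list n d \<phi>)" for i
    using that count[of i] count_list_0_iff[of "S_list n d \<phi>" i] by presburger
  then show "set (S_list n d \<phi>) \<subseteq> {1..n}" "\<forall>i\<in>set (S_list n d \<phi>). ?P i"
    by blast+
  have "sorted_wrt (\<lambda>i j. d j \<le> d i) (replicate k i)" for k i by (induction k) auto
  then have "sorted_wrt (\<lambda>i j. d j \<le> d i) (concat (map (\<lambda>i. replicate (d i) i) xs))"
    if "sorted_wrt (\<lambda>i j. d j \<le> d i) xs" for xs
    using that by (induction xs) (auto simp: sorted_wrt_append)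
  then show "sorted_wrt (\<lambda>i j. d j \<le> d i) (S_list n d \<phi>)"
    unfolding S_eq using sorted by (blast intro: sorted_wrt_filter)
qed

lemma T_list_properties:
  fixes d :: "nat \<Rightarrow> nat"
  assumes "degree_ranking n d \<phi>"
  shows "count_list (T_list n d \<phi>) i = (if i \<in> {1..n} \<and> d i \<le> half_degree n d then d i else 0)"
    and "set (T_list n d \<phi>) \<subseteq> {1..n}" and "\<forall>i\<in>set (T_list n d \<phi>). d i \<le> half_degree n d"
    and "sorted_wrt (\<lambda>i j. d i \<le> d j) (T_list n d \<phi>)"
proof -
  show count: "count_list (T_list n d \<phi>) i =
      (if i \<in> {1..n} \<and> d i \<le> half_degree n d then d i else 0)" for i
    unfolding T_list_def using ranked_nodes(1,2)[OF assms]
    by (subst count_list_concat_blocks) auto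
  have "i \<in> {1..n} \<and> d i \<le> half_degree n d" if "i \<in> set (T_list n d \<phi>)" for i
    using that count[of i] count_list_0_iff[of "T_list n d \<phi>" i] by presburger
  then show "set (T_list n d \<phi>) \<subseteq> {1..n}"
    "\<forall>i\<in>set (T_list n d \<phi>). d i \<le> half_degree n d"
    by blast+
  let ?block = "\<lambda>k. concat (replicate k (filter (\<lambda>i. d i = k) (ranked_nodes n \<phi>)))"
  \<comment> \<open>Each block is constant in degree, and the blocks follow each other in increasing
    degree.\<close>
  have "sorted_wrt (\<lambda>i j. d i \<le> d j) xs" if "\<forall>i\<in>set xs. d i = k" for xs k
    using that by (induction xs) auto
  then have block: "sorted_wrt (\<lambda>i j. d i \<le> d j) (?block k)" for k
    by force
  have "sorted_wrt (\<lambda>i j. d i \<le> d j) (concat (map ?block [0..<m]))" for m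
    by (induction m) (auto simp: sorted_wrt_append block)
  then show "sorted_wrt (\<lambda>i j. d i \<le> d j) (T_list n d \<phi>)"
    unfolding T_list_def by blast
qed

section \<open>Degrees after the joining phase\<close>

text \<open>Nodes of degree other than \<open>z\<close> occur in one list only and are used up.
  Nodes of degree \<open>z\<close> may occur in both, but entries of that degree are taken from at
  most one.\<close>

lemma degree_in_joined_edges:
  fixes d :: "nat \<Rightarrow> nat"
  assumes rank: "degree_ranking n d \<phi>" and i: "i \<in> {1..n}"
  shows "degree_in (joined_edges n d \<phi>) i \<le> d i"
    and "d i \<noteq> half_degree n d \<Longrightarrow> degree_in (joined_edges n d \<phi>) i = d i"
proof -
  define z where "z = half_degree n d"
  define S T where "S = S_list n d \<phi>" and "T = T_list n d \<phi>"
  note Sp = S_list_properties[OF rank, folded z_def S_def]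
  note Tp = T_list_properties[OF rank, folded z_def T_def]
  define ps where "ps = takeWhile (\<lambda>(i, j). \<not> (d i = z \<and> d j = z)) (zip S T)"
  have degree: "degree_in (joined_edges n d \<phi>) i =
      count_list (map fst ps) i + count_list (map snd ps) i"
    unfolding joined_edges_def ps_def S_def T_def z_def by (rule degree_in_Upairs)
  have lenS: "length (filter P S) = (\<Sum>i | i \<in> {1..n} \<and> P i \<and> z \<le> d i. d i)" for P
    using Sp(2) by (subst length_filter_eq_sum_count_list[of _ "{1..n}"])
      (auto simp: Sp(1) intro!: sum.mono_neutral_cong_right split: if_splits)
  have lenT: "length (filter P T) = (\<Sum>i | i \<in> {1..n} \<and> P i \<and> d i \<le> z. d i)" for P
    using Tp(2) by (subst length_filter_eq_sum_count_list[of _ "{1..n}"])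
      (auto simp: Tp(1) intro!: sum.mono_neutral_cong_right split: if_splits)
  have total: "total_degree n d =
      (\<Sum>i | i \<in> {1..n} \<and> P i. d i) + (\<Sum>i | i \<in> {1..n} \<and> \<not> P i. d i)" for P
    unfolding total_degree_def
    by (subst sum.union_disjoint[symmetric]) (auto intro!: sum.cong)
  have "length (filter (\<lambda>i. z < d i) S) \<le> length T"
  proof -
    have "length (filter (\<lambda>i. z < d i) S) = (\<Sum>i | i \<in> {1..n} \<and> \<not> d i \<le> z. d i)"
      unfolding lenS by (rule sum.cong) auto
    moreover have "length T = (\<Sum>i | i \<in> {1..n} \<and> d i \<le> z. d i)"
      using lenT[of "\<lambda>_. True"] by simp
    \<comment> \<open>The stubs above \<open>z\<close> make up at most half of all. For total degree
      zero, where \<open>half_degree\<close> says nothing, both sums vanish.\<close>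
    ultimately show ?thesis
      using total[of "\<lambda>i. d i \<le> z"] half_degree(1)[of n d, folded z_def] by linarith
  qed
  moreover have "length (filter (\<lambda>i. d i < z) T) \<le> length S"
  proof -
    have "length (filter (\<lambda>i. d i < z) T) = (\<Sum>i | i \<in> {1..n} \<and> d i < z. d i)"
      unfolding lenT by (rule sum.cong) auto
    moreover have "length S = (\<Sum>i | i \<in> {1..n} \<and> \<not> d i < z. d i)"
      using lenS[of "\<lambda>_. True"] by (simp add: not_less)
    ultimately show ?thesis
      using total[of "\<lambda>i. d i < z"] half_degree(2)[of n d, folded z_def] by linarith
  qed
  ultimately have counts: "z < d i \<Longrightarrow> count_list (map fst ps) i = count_list S i"
    "d i < z \<Longrightarrow> count_list (map snd ps) i = count_list T i"
    "d i = z \<Longrightarrow> count_list (map fst ps) i + count_list (map snd ps) i \<le>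
      max (count_list S i) (count_list T i)"
    unfolding ps_def using Sp(3,4) Tp(3,4) by (blast intro: joining_phase_counts)+
  have "set (map fst ps) \<subseteq> set S" "set (map snd ps) \<subseteq> set T"
    by (auto simp: ps_def dest!: set_takeWhileD dest: set_zip_leftD set_zip_rightD)
  then have "d i < z \<Longrightarrow> count_list (map fst ps) i = 0" "z < d i \<Longrightarrow> count_list (map snd ps) i = 0"
    using Sp(3) Tp(3) by (fastforce intro: count_notin)+
  then have "d i \<noteq> z \<Longrightarrow> degree_in (joined_edges n d \<phi>) i = d i"
    using counts(1,2) i by (cases "d i" z rule: linorder_cases) (auto simp: degree Sp(1) Tp(1))
  then show "degree_in (joined_edges n d \<phi>) i \<le> d i"
    "d i \<noteq> half_degree n d \<Longrightarrow> degree_in (joined_edges n d \<phi>) i = d i"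
    using counts(3) i by (cases "d i = z"; simp add: degree Sp(1) Tp(1) z_def)+
qed

text \<open>The common position \<open>p\<close> is kept because comparing two edges uses the order
  of both lists at once.\<close>

lemma joined_edges_conv_nth:
  assumes "e \<in># joined_edges n d \<phi>"
  obtains p where "p < length (S_list n d \<phi>)" "p < length (T_list n d \<phi>)"
    "e = Upair (S_list n d \<phi> ! p) (T_list n d \<phi> ! p)"
proof -
  obtain i j where "(i, j) \<in> set (zip (S_list n d \<phi>) (T_list n d \<phi>))" "e = Upair i j"
    using assms unfolding joined_edges_def by (auto dest: set_takeWhileD)
  then show thesis using that by (auto simp: in_set_zip)
qed

lemma joined_edges_subset:
  assumes "degree_ranking n d \<phi>" "e \<in># joined_edges n d \<phi>"
  shows "set_uprod e \<subseteq> {1..n}"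
proof -
  obtain p where p: "p < length (S_list n d \<phi>)" "p < length (T_list n d \<phi>)"
    and e: "e = Upair (S_list n d \<phi> ! p) (T_list n d \<phi> ! p)"
    using assms(2) by (rule joined_edges_conv_nth)
  have "S_list n d \<phi> ! p \<in> {1..n}" "T_list n d \<phi> ! p \<in> {1..n}"
    using p S_list_properties(2)[OF assms(1)] T_list_properties(2)[OF assms(1)] nth_mem
    by blast+
  then show ?thesis unfolding e by simp
qed

section \<open>Leftover stubs and optimality of every output\<close>

lemma unpaired_stubs:
  assumes rank: "degree_ranking n d \<phi>" and even: "even (total_degree n d)"
  shows "finite (unpaired_stubs n d \<phi>)" and "even (card (unpaired_stubs n d \<phi>))"
    and "i \<in> {1..n} \<Longrightarrow> degree_in (joined_edges n d \<phi>) i +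
      card {s \<in> unpaired_stubs n d \<phi>. fst s = i} = d i"
    and "s \<in> unpaired_stubs n d \<phi> \<Longrightarrow> fst s \<in> {1..n} \<and> d (fst s) = half_degree n d"
proof -
  let ?J = "joined_edges n d \<phi>"
  have eq: "unpaired_stubs n d \<phi> = Sigma {1..n} (\<lambda>i. {degree_in ?J i..<d i})"
    by (auto simp: unpaired_stubs_def)
  show "finite (unpaired_stubs n d \<phi>)" unfolding eq by auto
  have fibre: "{s \<in> unpaired_stubs n d \<phi>. fst s = i} = Pair i ` {degree_in ?J i..<d i}"
    if "i \<in> {1..n}" for i
    using that by (auto simp: eq)
  show "degree_in ?J i + card {s \<in> unpaired_stubs n d \<phi>. fst s = i} = d i" if "i \<in> {1..n}"
    using degree_in_joined_edges(1)[OF rank that] by (simp add: fibre[OF that] card_image inj_on_def)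
  show "fst s \<in> {1..n} \<and> d (fst s) = half_degree n d" if "s \<in> unpaired_stubs n d \<phi>"
    using that degree_in_joined_edges(2)[OF rank, of "fst s"] by (fastforce simp: eq)
  have "card (unpaired_stubs n d \<phi>) + (\<Sum>i=1..n. degree_in ?J i) = total_degree n d"
    unfolding eq total_degree_def
    by (simp add: sum.distrib[symmetric] degree_in_joined_edges(1)[OF rank])
  \<comment> \<open>Each joined edge uses two stubs, so the number of leftover stubs has the parity
    of the total degree.\<close>
  moreover have "even (\<Sum>i=1..n. degree_in ?J i)"
  proof -
    define ps where "ps = takeWhile (\<lambda>(i, j). \<not> (d i = half_degree n d \<and> d j = half_degree n d))
      (zip (S_list n d \<phi>) (T_list n d \<phi>))"
    have "set (map fst ps) \<subseteq> {1..n}" "set (map snd ps) \<subseteq> {1..n}"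
      using S_list_properties(2)[OF rank] T_list_properties(2)[OF rank]
      by (auto simp: ps_def dest!: set_takeWhileD dest: set_zip_leftD set_zip_rightD)
    then have "(\<Sum>i=1..n. count_list (map fst ps) i + count_list (map snd ps) i) = 2 * length ps"
      by (simp add: sum.distrib sum_count_set)
    then show ?thesis
      unfolding joined_edges_def degree_in_Upairs ps_def[symmetric] by simp
  qed
  ultimately show "even (card (unpaired_stubs n d \<phi>))" using even by (metis even_add)
qed

lemma disassortative_graph_optimal:
  assumes rank: "degree_ranking n d \<phi>" and even: "even (total_degree n d)"
    and "G \<in> set_pmf (disassortative_graph n d \<phi>)"
  shows "is_arg_min (joint_objective n d) (\<lambda>H. H \<in> graphs_with_degrees n d) G"
proof -
  let ?J = "joined_edges n d \<phi>" and ?R = "unpaired_stubs n d \<phi>"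
  let ?S = "S_list n d \<phi>" and ?T = "T_list n d \<phi>" and ?z = "half_degree n d"
  note R = unpaired_stubs[OF rank even]
  obtain P where P: "P \<in> stub_pairings ?R"
    and G: "G = ?J + image_mset (map_uprod fst) (mset_set P)"
    using assms(3) stub_pairings_nonempty[OF R(1,2)] finite_stub_pairings[OF R(1)]
    by (auto simp: disassortative_graph_def configuration_model_def)
  have rest: "set_uprod e \<subseteq> {i \<in> {1..n}. d i = ?z}"
    if "e \<in># image_mset (map_uprod fst) (mset_set P)" for e
    using that P R(4) finite_stub_pairing[OF R(1) P]
    by (fastforce simp: stub_pairings_def uprod.set_map)
  have "set_uprod e \<subseteq> {1..n}" if "e \<in># G" for e
    using that rest joined_edges_subset[OF rank] unfolding G by fastforce
  moreover have "degree_in G i = d i" if "i \<in> {1..n}" for i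
    unfolding G using R(3)[OF that] by (simp add: degree_in_stub_pairing[OF R(1) P])
  ultimately have mem: "G \<in> graphs_with_degrees n d"
    by (simp add: graphs_with_degrees_def)
  \<comment> \<open>Oriented from \<open>S_list\<close> to \<open>T_list\<close>; an arc of a joined
    edge may run either way.\<close>
  define joined where "joined i j \<longleftrightarrow>
    (\<exists>p. p < length ?S \<and> p < length ?T \<and> i = ?S ! p \<and> j = ?T ! p)" for i j
  have joined_z: "d j \<le> ?z \<and> ?z \<le> d i" if "joined i j" for i j
    using that S_list_properties(3)[OF rank] T_list_properties(3)[OF rank]
    by (auto simp: joined_def)
  \<comment> \<open>A later position has no larger degree in \<open>S_list\<close> and no smaller
    one in \<open>T_list\<close>. The second half serves reversed arcs.\<close>
  have joined_anti: "(d i < d i' \<longrightarrow> d j' \<le> d j) \<and> (d j < d j' \<longrightarrow> d i' \<le> d i)"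
    if joined: "joined i j" "joined i' j'" for i j i' j'
  proof -
    obtain p q where pq: "p < length ?S" "p < length ?T" "q < length ?S" "q < length ?T"
      and eq: "i = ?S ! p" "j = ?T ! p" "i' = ?S ! q" "j' = ?T ! q"
      using joined by (auto simp: joined_def)
    show ?thesis
      using sorted_wrt_nth_less[OF S_list_properties(4)[OF rank], of p q]
        sorted_wrt_nth_less[OF S_list_properties(4)[OF rank], of q p]
        sorted_wrt_nth_less[OF T_list_properties(4)[OF rank], of p q]
        sorted_wrt_nth_less[OF T_list_properties(4)[OF rank], of q p] pq
      unfolding eq by (cases p q rule: linorder_cases) auto
  qed
  have arcs: "joined i j \<or> joined j i \<or> d i = ?z \<and> d j = ?z" if "(i, j) \<in># arcs G" for i j
  proof -
    consider "Upair i j \<in># ?J" | "Upair i j \<in># image_mset (map_uprod fst) (mset_set P)"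
      using \<open>(i, j) \<in># arcs G\<close> unfolding mem_arcs_iff G by auto
    then show ?thesis
    proof cases
      case 1
      then show ?thesis
        by (rule joined_edges_conv_nth) (auto simp: joined_def)
    next
      case 2
      then show ?thesis using rest by fastforce
    qed
  qed
  show ?thesis
  proof (rule is_arg_min_countermonotone[OF mem])
    fix i j i' j'
    assume "(i, j) \<in># arcs G" "(i', j') \<in># arcs G" "d i < d i'"
    \<comment> \<open>Two joined arcs of equal orientation are compared by
      \<open>joined_anti\<close>; in all other combinations the degree \<open>?z\<close> separates
      the values.\<close>
    then show "d j' \<le> d j"
      using arcs[of i j] arcs[of i' j'] joined_z[of i j] joined_z[of j i] joined_z[of i' j']
        joined_z[of j' i'] joined_anti[of i j i' j'] joined_anti[of j i j' i']
      by linarith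
  qed
qed

text \<open>Optimality is shown for each realised degree sequence, any ranking and every graph in
  the support. Even total degree is necessary for a graph with these degrees to exist.\<close>

theorem theorem3p4:
  fixes M :: "'a measure" and \<eta> \<epsilon> :: real and f fs :: "nat pmf"
    and D :: "nat \<Rightarrow> 'a \<Rightarrow> nat \<Rightarrow> nat"
  assumes "prob_space M" and "\<eta> > 0" and "\<epsilon> > 0"
    and "degree_class M \<eta> \<epsilon> f fs D"
  shows "\<forall>n. \<forall>\<omega>\<in>space M. even (total_degree n (D n \<omega>)) \<longrightarrow>
           (\<forall>\<phi>. degree_ranking n (D n \<omega>) \<phi> \<longrightarrow>
             (\<forall>G\<in>set_pmf (disassortative_graph n (D n \<omega>) \<phi>).
               is_arg_min (joint_objective n (D n \<omega>))
                 (\<lambda>H. H \<in> graphs_with_degrees n (D n \<omega>)) G))"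
  using disassortative_graph_optimal by blast

end
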